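(* For a pattern $p$, let $F_p(x,y)=\sum_{n\geq 0}\sum_{k\geq 0} a_{n,k}x^ny^k$, where $a_{n,k}$ is the number of paths in $\mathcal{D}_n^{h,\geq}$ containing exactly $k$ occurrences of $p$. Then $$F_{UD}(x,y)=\frac{x^2-x^2y-xy+1-\sqrt{-4x^2+(x^2(y-1)+xy-1)^2}}{2x^2},$$ $$F_{UU}(x,y)=F_{DD}(x,y)=\frac{x^2y^2-x^2y-x+1-\sqrt{-4x^2y^2+(x^2y(y-1)-x+1)^2}}{2x^2y^2},$$ $$F_{DU}(x,y)=\frac{x^2y-x^2-xy+1-\sqrt{-4x^2+(x^2(y-1)+xy-1)^2}}{2x^2y}.$$
   Context: Dyck paths are lattice paths with steps $U=(1,1)$, $D=(1,-1)$ from $(0,0)$ to $(2n,0)$ never going below the $x$-axis ($n$ is the semilength). Every nonempty Dyck path $P$ has a unique first return decomposition $P=U\alpha D\beta$ with $\alpha,\beta$ Dyck paths. Let $h(P)$ denote the maximal height of a Dyck path. The set $\mathcal{D}^{h,\geq}$ is defined recursively: it contains the empty path, and a nonempty Dyck path $P=U\alpha D\beta$ belongs to $\mathcal{D}^{h,\geq}$ iff $\alpha,\beta\in\mathcal{D}^{h,\geq}$ and $h(U\alpha D)\geq h(\beta)$. $\mathcal{D}_n^{h,\geq}$ is the set of its elements of semilength $n$. An occurrence of a pattern (a word in $U,D$) in a path is an occurrence as a sequence of consecutive steps. *)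

theory Defs
  imports "HOL-Computational_Algebra.Computational_Algebra"
begin

datatype step = U | D

type_synonym lpath = "step list"

definition height :: "lpath \<Rightarrow> int" where
  "height w = int (count_list w U) - int (count_list w D)"

definition dyck :: "lpath \<Rightarrow> bool" where
  "dyck w \<longleftrightarrow> (\<forall>i \<le> length w. height (take i w) \<ge> 0) \<and> height w = 0"

definition max_height :: "lpath \<Rightarrow> int" where
  "max_height w = Max ((\<lambda>i. height (take i w)) ` {..length w})"

inductive_set hdyck :: "lpath set" where
  empty: "[] \<in> hdyck"
| first_return:
    "\<lbrakk>dyck \<alpha>; dyck \<beta>; \<alpha> \<in> hdyck; \<beta> \<in> hdyck; max_height (U # \<alpha> @ [D]) \<ge> max_height \<beta>\<rbrakk>
      \<Longrightarrow> U # \<alpha> @ D # \<beta> \<in> hdyck"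

lemma height_simps [simp]:
  "height [] = 0" "height (U # w) = height w + 1" "height (D # w) = height w - 1"
  "height (v @ w) = height v + height w"
  by (simp_all add: height_def)

lemma dyck_first_return:
  assumes "dyck \<alpha>" "dyck \<beta>"
  shows "dyck (U # \<alpha> @ D # \<beta>)"
  unfolding dyck_def
proof (intro conjI allI impI)
  show "height (U # \<alpha> @ D # \<beta>) = 0" using assms by (simp add: dyck_def)
  fix i assume i: "i \<le> length (U # \<alpha> @ D # \<beta>)"
  have *: "height (take j \<alpha>) \<ge> 0" "height (take j \<beta>) \<ge> 0" for j
    using assms by (cases "j \<le> length \<alpha>"; cases "j \<le> length \<beta>"; force simp: dyck_def)+
  have "height \<alpha> = 0" using assms by (simp add: dyck_def)
  then show "height (take i (U # \<alpha> @ D # \<beta>)) \<ge> 0"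
    using * by (auto simp: take_Cons intro: add_nonneg_nonneg split: nat.splits)
qed

lemma hdyck_imp_dyck: "w \<in> hdyck \<Longrightarrow> dyck w"
  by (induction rule: hdyck.induct) (auto intro: dyck_first_return, simp add: dyck_def)

lemma first_return_length_le:
  assumes "dyck \<alpha>" "dyck \<alpha>'" "\<alpha> @ D # \<beta> = \<alpha>' @ D # \<beta>'"
  shows "length \<alpha>' \<le> length \<alpha>"
proof (rule ccontr)
  assume *: "\<not> length \<alpha>' \<le> length \<alpha>"
  have "take (Suc (length \<alpha>)) (\<alpha> @ D # \<beta>) = take (Suc (length \<alpha>)) (\<alpha>' @ D # \<beta>')"
    using assms(3) by simp
  then have "height (take (Suc (length \<alpha>)) \<alpha>') = height (\<alpha> @ [D])"
    using * by simp
  moreover have "height (take (Suc (length \<alpha>)) \<alpha>') \<ge> 0"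
    using assms(2) * by (simp add: dyck_def)
  ultimately show False using assms(1) by (simp add: dyck_def)
qed

lemma first_return_unique:
  assumes "dyck \<alpha>" "dyck \<alpha>'" "\<alpha> @ D # \<beta> = \<alpha>' @ D # \<beta>'"
  shows "\<alpha> = \<alpha>' \<and> \<beta> = \<beta>'"
  using first_return_length_le[OF assms] first_return_length_le[OF assms(2,1) assms(3)[symmetric]]
    assms(3) by (simp add: append_eq_append_conv)

lemma hdyck_first_return_iff:
  assumes "dyck \<alpha>" "dyck \<beta>"
  shows "U # \<alpha> @ D # \<beta> \<in> hdyck \<longleftrightarrow>
    \<alpha> \<in> hdyck \<and> \<beta> \<in> hdyck \<and> max_height (U # \<alpha> @ [D]) \<ge> max_height \<beta>"
proof
  assume "U # \<alpha> @ D # \<beta> \<in> hdyck"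
  then show "\<alpha> \<in> hdyck \<and> \<beta> \<in> hdyck \<and> max_height (U # \<alpha> @ [D]) \<ge> max_height \<beta>"
  proof cases
    case (first_return \<alpha>' \<beta>')
    then have "\<alpha> = \<alpha>' \<and> \<beta> = \<beta>'"
      using assms(1) by (intro first_return_unique) auto
    with first_return show ?thesis by simp
  qed
qed (use assms hdyck.first_return in blast)

definition hdyck_n :: "nat \<Rightarrow> lpath set" where
  "hdyck_n n = {w \<in> hdyck. length w = 2 * n}"

definition occ :: "lpath \<Rightarrow> lpath \<Rightarrow> nat" where
  "occ p w = card {i. i + length p \<le> length w \<and> take (length p) (drop i w) = p}"

definition num_paths :: "lpath \<Rightarrow> nat \<Rightarrow> nat \<Rightarrow> nat" where
  "num_paths p n k = card {w \<in> hdyck_n n. occ p w = k}"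

text \<open>Bivariate series are power series in \<open>x\<close> whose coefficients are power series in \<open>y\<close>.\<close>

abbreviation X :: "rat fps fps" where
  "X \<equiv> fps_X"

abbreviation Y :: "rat fps fps" where
  "Y \<equiv> fps_const fps_X"

definition gen_fun :: "lpath \<Rightarrow> rat fps fps" where
  "gen_fun p = Abs_fps (\<lambda>n. Abs_fps (\<lambda>k. of_nat (num_paths p n k)))"

text \<open>The square root of a series with constant term 1 is the one with constant term 1;
  it exists and is unique by \<open>fps2_sqrt_ex1\<close> below.\<close>

definition fps2_sqrt :: "rat fps fps \<Rightarrow> rat fps fps" where
  "fps2_sqrt f = (THE s. s ^ 2 = f \<and> fps_nth (fps_nth s 0) 0 = 1)"

text \<open>The denominators in the generating functions are not units of the ring of series, so the
  quotients are taken in its fraction field.\<close>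

lemma to_fract_eq_divide_iff:
  assumes "h \<noteq> 0"
  shows "to_fract f = to_fract g / to_fract h \<longleftrightarrow> f * h = g"
  using assms by (simp add: to_fract_def eq_fract)

lemma fps2_sqrt_ex1:
  fixes f :: "rat fps fps"
  assumes "fps_nth (fps_nth f 0) 0 = 1"
  shows "\<exists>!s. s ^ 2 = f \<and> fps_nth (fps_nth s 0) 0 = 1"
proof -
  define r where "r = fps_radical (\<lambda>_ _. 1) 2 (fps_nth f 0)"
  have "r ^ Suc 1 = fps_nth f 0"
    unfolding r_def numeral_2_eq_2 One_nat_def
    by (subst power_radical[symmetric]) (use assms in auto)
  then have r: "r ^ 2 = fps_nth f 0" by (simp add: numeral_2_eq_2)
  have r0: "fps_nth r 0 = 1" by (simp add: r_def)
  then have ri: "inverse r * r = 1" by (simp add: inverse_mult_eq_1)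
  define g where "g = fps_const (inverse r ^ 2) * f - 1"
  have g0: "fps_nth g 0 = 0"
    using ri by (simp add: g_def r[symmetric] power_mult_distrib[symmetric])
  define b :: "rat fps fps" where "b = Abs_fps (\<lambda>n. fps_const ((1/2) gchoose n))"
  have "b * b = 1 + fps_X"
  proof (rule fps_ext)
    fix n
    have "fps_nth (b * b) n = fps_const (\<Sum>k=0..n. ((1/2) gchoose k) * ((1/2) gchoose (n - k)))"
      by (intro fps_ext) (simp add: b_def fps_mult_nth fps_sum_nth fps_const_mult)
    also have "\<dots> = fps_const (1 gchoose n)"
      by (subst gbinomial_Vandermonde) simp
    also have "\<dots> = fps_nth (1 + fps_X) n"
      using binomial_gbinomial[of 1 n, where 'a = rat]
      by (cases n; cases "n - 1") auto
    finally show "fps_nth (b * b) n = fps_nth (1 + fps_X) n" .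
  qed
  then have "fps_compose b g ^ 2 = 1 + g"
    using g0 by (simp add: power2_eq_square fps_compose_mult_distrib[symmetric]
        fps_compose_add_distrib)
  then have "(fps_const r * fps_compose b g) ^ 2 = fps_const (r ^ 2) * (1 + g)"
    by (simp add: power_mult_distrib)
  also have "\<dots> = fps_const (r ^ 2 * inverse r ^ 2) * f"
    unfolding g_def by (simp flip: mult.assoc)
  also have "r ^ 2 * inverse r ^ 2 = 1"
    using ri by (metis mult.commute power_mult_distrib power_one)
  finally have ex: "(fps_const r * fps_compose b g) ^ 2 = f" by simp
  have "fps_nth (fps_nth (fps_const r * fps_compose b g) 0) 0 = 1"
    by (simp add: r0 b_def)
  with ex show ?thesis
  proof (intro ex1I[of _ "fps_const r * fps_compose b g"] conjI)
    fix s assume "s ^ 2 = f \<and> fps_nth (fps_nth s 0) 0 = 1"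
    with ex have "s = fps_const r * fps_compose b g \<or> s = - (fps_const r * fps_compose b g)"
      by (metis power2_eq_iff)
    moreover have "s \<noteq> - (fps_const r * fps_compose b g)"
      using \<open>s ^ 2 = f \<and> fps_nth (fps_nth s 0) 0 = 1\<close> by (auto simp: r0 b_def)
    ultimately show "s = fps_const r * fps_compose b g" by blast
  qed auto
qed

end

theory Submission
  imports Defs
begin

text \<open>Let \<open>A\<^sub>k\<close> and \<open>B\<^sub>k\<close> be the generating functions of the paths of height exactly \<open>k\<close> and at most \<open>k\<close>.
  The first return decomposition gives \<open>A\<^sub>1 = a B\<^sub>1\<close> and \<open>A\<^sub>k\<^sub>+\<^sub>1 = c A\<^sub>k B\<^sub>k\<^sub>+\<^sub>1\<close> for \<open>k \<ge> 1\<close>, where \<open>(a, c)\<close> is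
  \<open>(xy, x)\<close> for the pattern \<open>UD\<close> and \<open>(x, xy)\<close> for \<open>UU\<close> and \<open>DD\<close>. Along this recursion
  \<open>(1 - c A\<^sub>k) / B\<^sub>k + c\<^sup>2 (B\<^sub>k - A\<^sub>k)\<close> is constant; its value at \<open>k = 1\<close> is \<open>J = 1 - a - c a + c\<^sup>2\<close>.
  Letting \<open>k\<close> tend to infinity, \<open>A\<^sub>k\<close> vanishes and \<open>B\<^sub>k\<close> becomes the full generating function \<open>F\<close>,
  so \<open>1 + c\<^sup>2 F\<^sup>2 = J F\<close>, which is solved by the square root of \<open>J\<^sup>2 - 4 c\<^sup>2\<close>. For \<open>DU\<close>, a nonempty path has
  one valley less than it has peaks.\<close>

section \<open>Heights\<close>

lemma height_le_length: "height w \<le> int (length w)"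
  using count_le_length[of w U] by (simp add: height_def)

lemma max_height_le_length: "max_height w \<le> int (length w)"
  unfolding max_height_def
proof (subst Max_le_iff)
  have "height (take i w) \<le> int (length w)" if "i \<le> length w" for i
    using height_le_length[of "take i w"] that by simp
  then show "\<forall>h\<in>(\<lambda>i. height (take i w)) ` {..length w}. h \<le> int (length w)" by auto
qed auto

lemma max_height_nonneg: "0 \<le> max_height w"
proof -
  have "height (take 0 w) \<le> max_height w"
    unfolding max_height_def by (intro Max_ge imageI) auto
  then show ?thesis by simp
qed

lemma max_height_Nil [simp]: "max_height [] = 0"
  by (simp add: max_height_def)

lemma max_height_Cons: "max_height (s # w) = max 0 (height [s] + max_height w)"
proof -
  have "(\<lambda>i. height (take i (s # w))) ` {..length (s # w)}
      = insert 0 ((\<lambda>i. height [s] + height (take i w)) ` {..length w})"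
    by (cases s) (auto simp: atMost_Suc_eq_insert_0 image_image)
  moreover have "(MAX i\<in>{..length w}. height [s] + height (take i w))
      = height [s] + max_height w"
    unfolding max_height_def by (subst add.commute, subst Max_add_commute) auto
  ultimately show ?thesis
    unfolding max_height_def[of "s # w"] by (simp del: height_simps)
qed

lemma max_height_append: "max_height (v @ w) = max (max_height v) (height v + max_height w)"
proof (induction v)
  case Nil
  then show ?case using max_height_nonneg[of w] by simp
next
  case (Cons s v)
  then show ?case by (cases s) (auto simp: max_height_Cons max_def)
qed

lemma max_height_elevated:
  assumes "dyck \<alpha>"
  shows "max_height (U # \<alpha> @ [D]) = 1 + max_height \<alpha>"
  using assms max_height_nonneg[of \<alpha>]
  by (simp add: max_height_Cons max_height_append dyck_def)

lemma max_height_first_return: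
  assumes "dyck \<alpha>"
  shows "max_height (U # \<alpha> @ D # \<beta>) = max (1 + max_height \<alpha>) (max_height \<beta>)"
  using assms max_height_nonneg[of \<alpha>] max_height_nonneg[of \<beta>]
  by (simp add: max_height_Cons max_height_append dyck_def)

lemma max_height_eq_0_iff:
  assumes "w \<in> hdyck"
  shows "max_height w = 0 \<longleftrightarrow> w = []"
  using assms
proof cases
  case (first_return \<alpha> \<beta>)
  then show ?thesis
    using max_height_nonneg[of \<alpha>] by (simp add: max_height_first_return max_def)
qed simp

section \<open>Occurrences of patterns of length two\<close>

lemma occ_Nil [simp]: "occ [a, b] [] = 0"
  by (simp add: occ_def)

lemma occ_Cons:
  "occ [a, b] (s # w) = (if s = a \<and> w \<noteq> [] \<and> hd w = b then 1 else 0) + occ [a, b] w"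
proof -
  let ?S = "\<lambda>w. {i. i + length [a, b] \<le> length w \<and> take (length [a, b]) (drop i w) = [a, b]}"
  have fin: "finite (?S w)"
    by (rule finite_subset[of _ "{..length w}"]) auto
  have 0: "0 \<in> ?S (s # w) \<longleftrightarrow> s = a \<and> w \<noteq> [] \<and> hd w = b"
    by (cases w) auto
  have Suc: "Suc i \<in> ?S (s # w) \<longleftrightarrow> i \<in> ?S w" for i by simp
  have "?S (s # w) = (if s = a \<and> w \<noteq> [] \<and> hd w = b then {0} else {}) \<union> Suc ` ?S w" (is "_ = ?R")
  proof (rule set_eqI)
    fix i show "i \<in> ?S (s # w) \<longleftrightarrow> i \<in> ?R"
      using 0 Suc by (cases i) (auto simp del: mem_Collect_eq)
  qed
  then have "card (?S (s # w)) =
      card (if s = a \<and> w \<noteq> [] \<and> hd w = b then {0::nat} else {}) + card (Suc ` ?S w)"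
    using fin by (subst card_Un_disjoint[symmetric]) auto
  then show ?thesis
    unfolding occ_def by (simp add: card_image split: if_splits)
qed

text \<open>A two-letter pattern can straddle the seam in only one position, so concatenation
  creates at most one new occurrence.\<close>

lemma occ_append:
  "occ [a, b] (v @ w) =
     occ [a, b] v + occ [a, b] w + (if v \<noteq> [] \<and> w \<noteq> [] \<and> last v = a \<and> hd w = b then 1 else 0)"
  by (induction v) (auto simp: occ_Cons)

lemma hdyck_hd_last:
  assumes "w \<in> hdyck" "w \<noteq> []"
  shows "hd w = U" "last w = D"
  using assms by (induction rule: hdyck.induct) auto

text \<open>Nonempty members start with \<open>U\<close> and end with \<open>D\<close>, so the
  letters at every seam depend only on whether \<alpha> and \<beta> are empty.\<close>

lemma occ_first_return:
  assumes "\<alpha> \<in> hdyck" "\<beta> \<in> hdyck"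
  shows "occ [U, D] (U # \<alpha> @ D # \<beta>) =
           occ [U, D] \<alpha> + occ [U, D] \<beta> + (if \<alpha> = [] then 1 else 0)"
    and "occ [U, U] (U # \<alpha> @ D # \<beta>) =
           occ [U, U] \<alpha> + occ [U, U] \<beta> + (if \<alpha> = [] then 0 else 1)"
    and "occ [D, D] (U # \<alpha> @ D # \<beta>) =
           occ [D, D] \<alpha> + occ [D, D] \<beta> + (if \<alpha> = [] then 0 else 1)"
    and "occ [D, U] (U # \<alpha> @ D # \<beta>) =
           occ [D, U] \<alpha> + occ [D, U] \<beta> + (if \<beta> = [] then 0 else 1)"
  using hdyck_hd_last[OF assms(1)] hdyck_hd_last[OF assms(2)]
  by (auto simp: occ_append occ_Cons hd_append)

lemma occ_UU_eq_DD: "w \<in> hdyck \<Longrightarrow> occ [U, U] w = occ [D, D] w"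
  by (induction rule: hdyck.induct) (auto simp: occ_first_return)

text \<open>The first arch has one peak more than valleys: its own peak if \<alpha> is empty,
  otherwise the surplus peak of \<alpha>. The surplus peak of a nonempty \<beta> is balanced by the
  valley at the return.\<close>

lemma occ_UD_eq_Suc_DU: "w \<in> hdyck \<Longrightarrow> w \<noteq> [] \<Longrightarrow> occ [U, D] w = Suc (occ [D, U] w)"
  by (induction rule: hdyck.induct) (auto simp: occ_first_return)

section \<open>Weighted generating functions\<close>

definition hdyck_eq :: "nat \<Rightarrow> lpath set" where
  "hdyck_eq k = {w \<in> hdyck. max_height w = int k}"

definition hdyck_le :: "nat \<Rightarrow> lpath set" where
  "hdyck_le k = {w \<in> hdyck. max_height w \<le> int k}"

text \<open>Weights lie in an arbitrary integral domain: with \<open>rat fps\<close> the variable y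
  sits in the coefficients, and one recursion serves all patterns.\<close>

definition wgf :: "lpath set \<Rightarrow> (lpath \<Rightarrow> 'a::idom) \<Rightarrow> 'a fps" where
  "wgf S wt = Abs_fps (\<lambda>n. \<Sum>w\<in>{w \<in> S. length w = 2 * n}. wt w)"

lemma UNIV_step: "(UNIV :: step set) = {U, D}"
  using step.exhaust by auto

lemma finite_fixed_length: "finite {w \<in> S :: lpath set. length w = n}"
proof (rule finite_subset)
  show "finite {w :: lpath. set w \<subseteq> {U, D} \<and> length w = n}"
    by (rule finite_lists_length_eq) simp
qed (use UNIV_step in auto)

lemma hdyck_even_length: "w \<in> hdyck \<Longrightarrow> even (length w)"
  by (induction rule: hdyck.induct) auto

lemma hdyck_eq_0: "hdyck_eq 0 = {[]}" and hdyck_le_0: "hdyck_le 0 = {[]}"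
proof -
  have "[] \<in> hdyck" by (rule hdyck.empty)
  then show "hdyck_eq 0 = {[]}" "hdyck_le 0 = {[]}"
    using max_height_eq_0_iff order.antisym[OF _ max_height_nonneg]
    by (auto simp: hdyck_eq_def hdyck_le_def)
qed

lemma wgf_Nil: "wgf {[]} wt = fps_const (wt [])"
proof (rule fps_ext)
  fix n
  have "{w \<in> {[]}. length w = 2 * n} = (if n = 0 then {[]} else {} :: lpath set)" by auto
  then show "fps_nth (wgf {[]} wt) n = fps_nth (fps_const (wt [])) n"
    by (simp add: wgf_def)
qed

lemma wgf_Un_disjoint:
  assumes "S \<inter> T = {}"
  shows "wgf (S \<union> T) wt = wgf S wt + wgf T wt"
proof (rule fps_ext)
  fix n
  have "{w \<in> S \<union> T. length w = 2 * n} = {w \<in> S. length w = 2 * n} \<union> {w \<in> T. length w = 2 * n}"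
    by auto
  then show "fps_nth (wgf (S \<union> T) wt) n = fps_nth (wgf S wt + wgf T wt) n"
    using assms finite_fixed_length by (simp add: wgf_def) (subst sum.union_disjoint; auto)
qed

lemma wgf_hdyck_le_Suc: "wgf (hdyck_le (Suc k)) wt = wgf (hdyck_le k) wt + wgf (hdyck_eq (Suc k)) wt"
proof -
  have "hdyck_le (Suc k) = hdyck_le k \<union> hdyck_eq (Suc k)"
    by (auto simp: hdyck_le_def hdyck_eq_def)
  moreover have "hdyck_le k \<inter> hdyck_eq (Suc k) = {}"
    by (auto simp: hdyck_le_def hdyck_eq_def)
  ultimately show ?thesis by (simp add: wgf_Un_disjoint)
qed

text \<open>Uniqueness of the first return turns paths into pairs, hence coefficients into a Cauchy
  product; the extra \<open>U\<close> and \<open>D\<close> raise the semilength by one, which is the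
  factor \<open>fps_X\<close>.\<close>

lemma wgf_first_return:
  fixes wt :: "lpath \<Rightarrow> 'a::idom"
  assumes S: "S \<subseteq> hdyck" and T: "T \<subseteq> hdyck"
    and wt: "\<And>\<alpha> \<beta>. \<alpha> \<in> S \<Longrightarrow> \<beta> \<in> T \<Longrightarrow> wt (U # \<alpha> @ D # \<beta>) = c * wt \<alpha> * wt \<beta>"
  shows "wgf ((\<lambda>(\<alpha>, \<beta>). U # \<alpha> @ D # \<beta>) ` (S \<times> T)) wt
    = fps_const c * fps_X * wgf S wt * wgf T wt" (is "wgf (?f ` _) _ = _")
proof (rule fps_ext)
  fix n
  let ?W = "{w \<in> ?f ` (S \<times> T). length w = 2 * n}"
  show "fps_nth (wgf (?f ` (S \<times> T)) wt) n
      = fps_nth (fps_const c * fps_X * wgf S wt * wgf T wt) n"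
  proof (cases n)
    case 0
    then have W: "?W = {}" by auto
    have "fps_nth (wgf (?f ` (S \<times> T)) wt) n = (\<Sum>w\<in>?W. wt w)"
      by (simp add: wgf_def)
    also have "\<dots> = fps_nth (fps_const c * fps_X * wgf S wt * wgf T wt) n"
      unfolding W by (simp add: 0 mult.assoc)
    finally show ?thesis .
  next
    case (Suc m)
    let ?L = "\<lambda>S i. {w \<in> S. length w = 2 * (i::nat)}"
    \<comment> \<open>The semilength \<open>i\<close> of \<alpha> is carried along so that the sum
      splits as in a Cauchy product. It is determined by \<alpha>, so \<open>?g\<close> remains
      injective.\<close>
    let ?P = "SIGMA i:{0..m}. ?L S i \<times> ?L T (m - i)"
    let ?g = "\<lambda>(i :: nat, p). ?f p"
    have dyck: "dyck \<alpha>" if "\<alpha> \<in> S" for \<alpha>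
      using that S hdyck_imp_dyck by blast
    have inj: "inj_on ?g ?P"
    proof (rule inj_onI)
      fix q q' assume q: "q \<in> ?P" "q' \<in> ?P" "?g q = ?g q'"
      obtain i \<alpha> \<beta> j \<alpha>' \<beta>' where [simp]: "q = (i, \<alpha>, \<beta>)" "q' = (j, \<alpha>', \<beta>')"
        by (cases q, cases q') auto
      have "\<alpha> = \<alpha>' \<and> \<beta> = \<beta>'"
        using q by (intro first_return_unique dyck) auto
      with q show "q = q'" by auto
    qed
    have "?W \<subseteq> ?g ` ?P"
    proof clarify
      fix \<alpha> \<beta> assume *: "\<alpha> \<in> S" "\<beta> \<in> T" "length (U # \<alpha> @ D # \<beta>) = 2 * n"
      have "even (length \<alpha>)" using * S hdyck_even_length by blast
      then obtain i where i: "length \<alpha> = 2 * i" by (elim evenE)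
      then have "(i, \<alpha>, \<beta>) \<in> ?P" using * Suc by auto
      then show "U # \<alpha> @ D # \<beta> \<in> ?g ` ?P" by force
    qed
    moreover have "?g ` ?P \<subseteq> ?W" using Suc by auto
    ultimately have W: "?W = ?g ` ?P" by blast
    have "fps_nth (wgf (?f ` (S \<times> T)) wt) n = (\<Sum>w\<in>?W. wt w)"
      by (simp add: wgf_def)
    also have "\<dots> = (\<Sum>q\<in>?P. wt (?g q))"
      unfolding W using inj by (subst sum.reindex) (auto simp: o_def)
    also have "\<dots> = (\<Sum>(i, \<alpha>, \<beta>)\<in>?P. c * wt \<alpha> * wt \<beta>)"
      using wt by (intro sum.cong) auto
    also have "\<dots> = (\<Sum>i=0..m. \<Sum>(\<alpha>, \<beta>)\<in>?L S i \<times> ?L T (m - i). c * wt \<alpha> * wt \<beta>)"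
      using finite_fixed_length by (subst sum.Sigma) auto
    also have "\<dots> = (\<Sum>i=0..m. c * ((\<Sum>\<alpha>\<in>?L S i. wt \<alpha>) * (\<Sum>\<beta>\<in>?L T (m - i). wt \<beta>)))"
      by (intro sum.cong refl)
        (simp only: sum_product sum.cartesian_product, subst sum_distrib_left,
          simp add: case_prod_unfold mult.assoc)
    also have "\<dots> = c * fps_nth (wgf S wt * wgf T wt) m"
      by (simp add: fps_mult_nth wgf_def sum_distrib_left)
    also have "\<dots> = fps_nth (fps_const c * fps_X * wgf S wt * wgf T wt) n"
      by (simp add: Suc mult.assoc)
    finally show ?thesis .
  qed
qed

section \<open>Recursion on the height\<close>

text \<open>The height condition says that the first arch attains the maximum, so \<alpha> has
  height exactly \<open>k\<close> while \<beta> is merely bounded by \<open>Suc k\<close>.\<close>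

lemma hdyck_eq_Suc:
  "hdyck_eq (Suc k) = (\<lambda>(\<alpha>, \<beta>). U # \<alpha> @ D # \<beta>) ` (hdyck_eq k \<times> hdyck_le (Suc k))" (is "_ = ?R")
proof
  show "hdyck_eq (Suc k) \<subseteq> ?R"
  proof
    fix w assume w: "w \<in> hdyck_eq (Suc k)"
    then have "w \<in> hdyck" by (simp add: hdyck_eq_def)
    then show "w \<in> ?R"
    proof cases
      case (first_return \<alpha> \<beta>)
      then have "\<alpha> \<in> hdyck_eq k" "\<beta> \<in> hdyck_le (Suc k)"
        using w by (auto simp: hdyck_eq_def hdyck_le_def max_height_first_return
            max_height_elevated)
      with first_return show ?thesis by auto
    qed (use w in \<open>simp add: hdyck_eq_def\<close>)
  qed
  show "?R \<subseteq> hdyck_eq (Suc k)"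
  proof clarify
    fix \<alpha> \<beta> assume "\<alpha> \<in> hdyck_eq k" "\<beta> \<in> hdyck_le (Suc k)"
    then show "U # \<alpha> @ D # \<beta> \<in> hdyck_eq (Suc k)"
      by (auto simp: hdyck_eq_def hdyck_le_def hdyck_first_return_iff hdyck_imp_dyck
          max_height_first_return max_height_elevated)
  qed
qed

lemma hdyck_eq_le_length: "w \<in> hdyck_eq k \<Longrightarrow> k \<le> length w"
  using max_height_le_length[of w] by (simp add: hdyck_eq_def)

text \<open>A path rises at most one unit per step; this coarse bound already makes the series tend
  to zero coefficientwise as \<open>k\<close> grows.\<close>

lemma wgf_hdyck_eq_nth_0: "2 * n < k \<Longrightarrow> fps_nth (wgf (hdyck_eq k) wt) n = 0"
  by (force simp: wgf_def dest: hdyck_eq_le_length intro!: sum.neutral)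

lemma wgf_hdyck_le_nth:
  assumes "2 * n \<le> k"
  shows "fps_nth (wgf (hdyck_le k) wt) n = fps_nth (wgf hdyck wt) n"
proof -
  have "{w \<in> hdyck_le k. length w = 2 * n} = {w \<in> hdyck. length w = 2 * n}"
    using assms by (auto simp: hdyck_le_def intro: order.trans[OF max_height_le_length])
  then show ?thesis by (simp add: wgf_def)
qed

section \<open>The invariant and its limit\<close>

text \<open>This is the constancy of the invariant multiplied through by \<open>B (Suc k)\<close>,
  with \<open>B (Suc k) - A (Suc k)\<close> replaced by \<open>B k\<close>; in an integral domain
  cancellation takes the place of division.\<close>

lemma first_return_invariant:
  fixes A B :: "nat \<Rightarrow> 'a::idom"
  assumes B0: "B 0 = 1" and A1: "A 1 = a * B 1"
    and A: "\<And>k. A (Suc (Suc k)) = c * A (Suc k) * B (Suc (Suc k))"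
    and B: "\<And>k. B (Suc k) = B k + A (Suc k)"
    and nz: "\<And>k. B k \<noteq> 0"
  shows "1 - c * A (Suc k) + c^2 * B k * B (Suc k) = (1 - a - c * a + c^2) * B (Suc k)"
proof (induction k)
  case 0
  have "B 1 * (1 - a) = 1" using B[of 0] A1 B0 by (simp add: algebra_simps)
  then show ?case using A1 B0 by simp algebra
next
  case (Suc k)
  \<comment> \<open>The recursion gives
    \<open>B (Suc (Suc k)) * (1 - c * A (Suc k)) = B (Suc k)\<close>, so the induction hypothesis is
    multiplied by \<open>B (Suc (Suc k))\<close>.\<close>
  have "B (Suc k) * 1 = B (Suc k) * (B (Suc (Suc k)) * (1 - a - c * a + c^2 - c^2 * B k))"
    using Suc A[of k] B[of "Suc k"] by algebra
  then have "1 = B (Suc (Suc k)) * (1 - a - c * a + c^2 - c^2 * B k)"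
    using nz mult_left_cancel by blast
  \<comment> \<open>Here \<open>c * A (Suc (Suc k))\<close> equals
    \<open>c^2 * (B (Suc k) - B k) * B (Suc (Suc k))\<close>, which advances the index of the
    quadratic term.\<close>
  then show ?case using A[of k] B[of k] by algebra
qed

text \<open>The first arch has empty interior exactly when the path has height 1, so
  \<open>a\<close> governs the first level and \<open>c\<close> all higher ones. The invariant then
  passes to the limit.\<close>

lemma wgf_hdyck_quadratic:
  fixes wt :: "lpath \<Rightarrow> 'a::idom"
  assumes Nil: "wt [] = 1"
    and peak: "\<And>\<beta>. \<beta> \<in> hdyck \<Longrightarrow> wt (U # D # \<beta>) = a * wt \<beta>"
    and step: "\<And>\<alpha> \<beta>. \<alpha> \<in> hdyck \<Longrightarrow> \<beta> \<in> hdyck \<Longrightarrow> \<alpha> \<noteq> [] \<Longrightarrow>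
      wt (U # \<alpha> @ D # \<beta>) = c * wt \<alpha> * wt \<beta>"
  defines "F \<equiv> wgf hdyck wt"
    and "a' \<equiv> fps_const a * fps_X" and "c' \<equiv> fps_const c * fps_X"
  shows "1 + c'^2 * F^2 = (1 - a' - c' * a' + c'^2) * F"
proof -
  define A where "A k = wgf (hdyck_eq k) wt" for k
  define B where "B k = wgf (hdyck_le k) wt" for k
  have sub: "hdyck_eq k \<subseteq> hdyck" "hdyck_le k \<subseteq> hdyck" for k
    by (auto simp: hdyck_eq_def hdyck_le_def)
  have A0: "A 0 = 1" and B0: "B 0 = 1"
    by (simp_all add: A_def B_def hdyck_eq_0 hdyck_le_0 wgf_Nil Nil)
  have "A 1 = a' * A 0 * B 1"
    unfolding A_def B_def a'_def One_nat_def hdyck_eq_Suc using sub(1)[of 0] sub(2)[of 1] peak Nil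
    by (intro wgf_first_return) (auto simp: hdyck_eq_0)
  then have A1: "A 1 = a' * B 1" by (simp add: A0)
  have A: "A (Suc (Suc k)) = c' * A (Suc k) * B (Suc (Suc k))" for k
  proof -
    have "[] \<notin> hdyck_eq (Suc k)" by (simp add: hdyck_eq_def)
    then show ?thesis
      unfolding A_def B_def c'_def hdyck_eq_Suc[of "Suc k"] using sub step
      by (intro wgf_first_return) blast+
  qed
  have B: "B (Suc k) = B k + A (Suc k)" for k
    unfolding A_def B_def by (rule wgf_hdyck_le_Suc)
  \<comment> \<open>The empty path gives constant term 1, hence the nonvanishing that the
    cancellation requires.\<close>
  have "fps_nth (B k) 0 = 1" for k
    using wgf_hdyck_le_nth[of 0 k wt] wgf_hdyck_le_nth[of 0 0 wt] B0 by (simp add: B_def)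
  then have "B k \<noteq> 0" for k by (metis fps_zero_nth zero_neq_one)
  note inv = first_return_invariant[OF B0 A1 A B this]
  show ?thesis
  proof (rule fps_ext)
    fix n :: nat
    \<comment> \<open>At this level, up to coefficient \<open>n\<close>, the series
      \<open>A (Suc ?k)\<close> vanishes and both \<open>B ?k\<close> and \<open>B (Suc ?k)\<close>
      agree with \<open>F\<close>; the limit becomes a comparison of coefficients.\<close>
    let ?k = "2 * n"
    have AF: "fps_nth (A (Suc ?k)) i = 0" if "i \<le> n" for i
      using that by (simp add: A_def wgf_hdyck_eq_nth_0)
    have BF: "fps_nth (B ?k) i = fps_nth F i" "fps_nth (B (Suc ?k)) i = fps_nth F i"
      if "i \<le> n" for i
      using that by (simp_all add: B_def F_def wgf_hdyck_le_nth)
    have cong: "fps_nth (f * g) i = fps_nth (f' * g') i"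
      if "i \<le> n" "\<And>i. i \<le> n \<Longrightarrow> fps_nth f i = fps_nth f' i"
        "\<And>i. i \<le> n \<Longrightarrow> fps_nth g i = fps_nth g' i" for f f' g g' :: "'a fps" and i
      using that by (auto simp: fps_mult_nth intro!: sum.cong)
    have "fps_nth (1 + c'^2 * F^2) n
        = fps_nth (1 - c' * A (Suc ?k) + c'^2 * B ?k * B (Suc ?k)) n"
    proof -
      have "fps_nth (c' * A (Suc ?k)) n = fps_nth (c' * 0) n"
        by (intro cong) (auto simp: AF)
      moreover have "fps_nth (c'^2 * F * F) n = fps_nth (c'^2 * B ?k * B (Suc ?k)) n"
        by (intro cong) (auto simp: BF)
      ultimately show ?thesis by (simp add: power2_eq_square[of F] mult.assoc)
    qed
    also have "\<dots> = fps_nth ((1 - a' - c' * a' + c'^2) * B (Suc ?k)) n"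
      by (simp only: inv)
    also have "\<dots> = fps_nth ((1 - a' - c' * a' + c'^2) * F) n"
      by (intro cong) (auto simp: BF)
    finally show "fps_nth (1 + c'^2 * F^2) n = fps_nth ((1 - a' - c' * a' + c'^2) * F) n" .
  qed
qed

section \<open>Specialisation to the four patterns\<close>

lemma gen_fun_eq_wgf: "gen_fun p = wgf hdyck (\<lambda>w. fps_X ^ occ p w)"
proof (intro fps_ext)
  fix n k
  let ?W = "{w \<in> hdyck. length w = 2 * n}"
  have "fps_nth (fps_nth (wgf hdyck (\<lambda>w. fps_X ^ occ p w)) n) k
      = (\<Sum>w\<in>?W. if k = occ p w then 1 else 0 :: rat)"
    by (simp add: wgf_def fps_sum_nth fps_X_power_nth)
  also have "\<dots> = of_nat (card {w \<in> ?W. occ p w = k})"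
    using finite_fixed_length by (subst sum.inter_filter[symmetric]) (auto intro!: arg_cong[of _ _ card])
  finally show "fps_nth (fps_nth (gen_fun p) n) k
      = fps_nth (fps_nth (wgf hdyck (\<lambda>w. fps_X ^ occ p w)) n) k"
    by (simp add: gen_fun_def num_paths_def hdyck_n_def)
qed

lemma gen_fun_UU_eq_DD: "gen_fun [U, U] = gen_fun [D, D]"
  unfolding gen_fun_eq_wgf wgf_def
  by (intro arg_cong[of _ _ Abs_fps] ext sum.cong) (auto simp: occ_UU_eq_DD)

lemma gen_fun_UD_quadratic:
  "1 + X^2 * gen_fun [U, D]^2 = (1 - X*Y - X^2*Y + X^2) * gen_fun [U, D]"
proof -
  \<comment> \<open>Only an arch with empty interior adds a peak: \<open>a\<close> is y and
    \<open>c\<close> is 1. Writing \<open>fps_const 1\<close> matches the shape of the general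
    equation.\<close>
  have "1 + (fps_const 1 * X)^2 * gen_fun [U, D]^2
      = (1 - Y * X - fps_const 1 * X * (Y * X) + (fps_const 1 * X)^2) * gen_fun [U, D]"
    unfolding gen_fun_eq_wgf
  proof (intro wgf_hdyck_quadratic)
    show "fps_X ^ occ [U, D] (U # D # \<beta>) = fps_X * (fps_X ^ occ [U, D] \<beta> :: rat fps)"
      if "\<beta> \<in> hdyck" for \<beta>
      using occ_first_return(1)[OF hdyck.empty that] by simp
  qed (auto simp: occ_first_return power_add)
  then show ?thesis by (simp add: algebra_simps power2_eq_square)
qed

lemma gen_fun_UU_quadratic:
  "1 + (X*Y)^2 * gen_fun [U, U]^2 = (1 - X - X^2*Y + (X*Y)^2) * gen_fun [U, U]"
proof -
  \<comment> \<open>The roles are swapped: an arch adds a \<open>UU\<close> exactly when its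
    interior is nonempty.\<close>
  have "1 + (Y * X)^2 * gen_fun [U, U]^2
      = (1 - fps_const 1 * X - Y * X * (fps_const 1 * X) + (Y * X)^2) * gen_fun [U, U]"
    unfolding gen_fun_eq_wgf
  proof (intro wgf_hdyck_quadratic)
    show "fps_X ^ occ [U, U] (U # D # \<beta>) = 1 * (fps_X ^ occ [U, U] \<beta> :: rat fps)"
      if "\<beta> \<in> hdyck" for \<beta>
      using occ_first_return(2)[OF hdyck.empty that] by simp
  qed (auto simp: occ_first_return power_add)
  then show ?thesis by (simp add: algebra_simps power2_eq_square)
qed

text \<open>Subtracting 1 removes the empty path, which has neither peaks nor valleys; every other
  path has one extra peak, hence the factor \<open>Y\<close>.\<close>

lemma gen_fun_UD_DU: "gen_fun [U, D] - 1 = Y * (gen_fun [D, U] - 1)"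
proof -
  have split: "gen_fun p = 1 + wgf (hdyck - {[]}) (\<lambda>w. fps_X ^ occ p w)" if "occ p [] = 0" for p
  proof -
    have "hdyck = {[]} \<union> (hdyck - {[]})" using hdyck.empty by auto
    then have "gen_fun p = wgf ({[]} \<union> (hdyck - {[]})) (\<lambda>w. fps_X ^ occ p w)"
      by (simp add: gen_fun_eq_wgf)
    also have "\<dots> = 1 + wgf (hdyck - {[]}) (\<lambda>w. fps_X ^ occ p w)"
      by (subst wgf_Un_disjoint) (auto simp: wgf_Nil that)
    finally show ?thesis .
  qed
  have "wgf (hdyck - {[]}) (\<lambda>w. fps_X ^ occ [U, D] w :: rat fps)
      = Y * wgf (hdyck - {[]}) (\<lambda>w. fps_X ^ occ [D, U] w)"
    by (rule fps_ext) (simp add: wgf_def occ_UD_eq_Suc_DU sum_distrib_left)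
  then show ?thesis by (simp add: split)
qed

section \<open>Solving the quadratic equations\<close>

lemma fps2_sqrt_eq:
  assumes "s^2 = f" "fps_nth (fps_nth s 0) 0 = 1"
  shows "fps2_sqrt f = s"
proof -
  have "fps_nth f 0 = fps_nth s 0 ^ 2" using assms(1) by (auto simp: power2_eq_square)
  then have "fps_nth (fps_nth f 0) 0 = 1" using assms(2) by (simp add: power2_eq_square)
  then show ?thesis
    unfolding fps2_sqrt_def using assms by (intro the1_equality fps2_sqrt_ex1) auto
qed

text \<open>Completing the square gives \<open>(J - 2 * c^2 * F)^2 = J^2 - 4 * c^2\<close>. The sign
  of the root is settled by the constant term, which is that of \<open>J\<close> because
  \<open>c\<close> has none.\<close>

lemma fps2_sqrt_discriminant:
  assumes quad: "1 + c^2 * F^2 = J * F"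
    and c0: "fps_nth c 0 = 0" and J0: "fps_nth J 0 = 1"
  shows "fps2_sqrt (J^2 - 4 * c^2) = J - 2 * c^2 * F"
proof (rule fps2_sqrt_eq)
  show "(J - 2 * c^2 * F)^2 = J^2 - 4 * c^2" using quad by algebra
  show "fps_nth (fps_nth (J - 2 * c^2 * F) 0) 0 = 1"
    using c0 J0 by (simp add: power2_eq_square)
qed

theorem theorem2:
  shows
    "to_fract (gen_fun [U, D]) =
       to_fract (X^2 - X^2*Y - X*Y + 1 - fps2_sqrt (- 4*X^2 + (X^2*(Y - 1) + X*Y - 1)^2))
         / to_fract (2*X^2)
     \<and> gen_fun [U, U] = gen_fun [D, D]
     \<and> to_fract (gen_fun [D, D]) =
       to_fract (X^2*Y^2 - X^2*Y - X + 1
                   - fps2_sqrt (- 4*X^2*Y^2 + (X^2*Y*(Y - 1) - X + 1)^2))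
         / to_fract (2*X^2*Y^2)
     \<and> to_fract (gen_fun [D, U]) =
       to_fract (X^2*Y - X^2 - X*Y + 1 - fps2_sqrt (- 4*X^2 + (X^2*(Y - 1) + X*Y - 1)^2))
         / to_fract (2*X^2*Y)"
proof (intro conjI)
  let ?J = "X^2 - X^2*Y - X*Y + 1"
  have "fps2_sqrt (?J^2 - 4 * X^2) = ?J - 2 * X^2 * gen_fun [U, D]"
    using gen_fun_UD_quadratic by (intro fps2_sqrt_discriminant) (auto simp: algebra_simps)
  \<comment> \<open>The polynomial squared on the right is \<open>- ?J\<close>.\<close>
  moreover have "?J^2 - 4 * X^2 = - 4*X^2 + (X^2*(Y - 1) + X*Y - 1)^2" by algebra
  ultimately have sqrt:
    "fps2_sqrt (- 4*X^2 + (X^2*(Y - 1) + X*Y - 1)^2) = ?J - 2 * X^2 * gen_fun [U, D]" by (simp only:)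
  show "to_fract (gen_fun [U, D]) =
      to_fract (?J - fps2_sqrt (- 4*X^2 + (X^2*(Y - 1) + X*Y - 1)^2)) / to_fract (2*X^2)"
    unfolding sqrt by (subst to_fract_eq_divide_iff) (simp_all add: algebra_simps)
  \<comment> \<open>Multiplying the peak-valley relation by \<open>2*X^2\<close> adds
    \<open>2*X^2*Y - 2*X^2\<close> to the numerator, turning \<open>?J\<close> into
    \<open>X^2*Y - X^2 - X*Y + 1\<close>.\<close>
  have "gen_fun [D, U] * (2*X^2*Y) = X^2*Y - X^2 - X*Y + 1 - (?J - 2 * X^2 * gen_fun [U, D])"
    using gen_fun_UD_DU by algebra
  then show "to_fract (gen_fun [D, U]) =
      to_fract (X^2*Y - X^2 - X*Y + 1 - fps2_sqrt (- 4*X^2 + (X^2*(Y - 1) + X*Y - 1)^2))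
        / to_fract (2*X^2*Y)"
    unfolding sqrt by (subst to_fract_eq_divide_iff) simp_all
  show "gen_fun [U, U] = gen_fun [D, D]" by (rule gen_fun_UU_eq_DD)
  let ?K = "X^2*Y^2 - X^2*Y - X + 1"
  have "fps2_sqrt (?K^2 - 4 * (X*Y)^2) = ?K - 2 * (X*Y)^2 * gen_fun [D, D]"
    using gen_fun_UU_quadratic unfolding gen_fun_UU_eq_DD
    by (intro fps2_sqrt_discriminant) (auto simp: algebra_simps power_mult_distrib)
  moreover have "?K^2 - 4 * (X*Y)^2 = - 4*X^2*Y^2 + (X^2*Y*(Y - 1) - X + 1)^2" by algebra
  ultimately have sqrt: "fps2_sqrt (- 4*X^2*Y^2 + (X^2*Y*(Y - 1) - X + 1)^2)
      = ?K - 2 * (X*Y)^2 * gen_fun [D, D]" by (simp only:)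
  show "to_fract (gen_fun [D, D]) =
      to_fract (?K - fps2_sqrt (- 4*X^2*Y^2 + (X^2*Y*(Y - 1) - X + 1)^2))
        / to_fract (2*X^2*Y^2)"
    unfolding sqrt by (subst to_fract_eq_divide_iff) (simp_all add: algebra_simps)
qed

end
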